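(* Let $G$ be a connected simple undirected graph on nodes $\{0,\dots,n\}$ with $N=n+1>1$, and let $F$ be a facet of the adjacency polytope $\nabla_G$ whose facet subnetwork $(\mathcal{V}_F,\mathcal{E}_F)$ is primitive, i.e. it is a weakly connected acyclic directed graph containing all vertices $0,\dots,n$ and exactly $n$ directed edges. Then, for generic complex coefficients $\{c_k\},\{a_{kij}\}$, the facet subsystem $$c_k-\sum_{(i,j)\in\mathcal{E}_F} a_{kij}\,\frac{x_i}{x_j}=0,\qquad k=1,\dots,n,\quad x_0=1,$$ has a unique complex solution $(x_1,\dots,x_n)$ with $x_i\neq0$ for each $i=1,\dots,n$.
   Context: Let $\mathbf{e}_1,\dots,\mathbf{e}_n$ be the standard basis of $\mathbb{R}^n$ and $\mathbf{e}_0=\mathbf{0}$. Each undirected edge $\{i,j\}$ gives directed edges $(i,j),(j,i)$, forming $\mathcal{E}(G)$; the adjacency polytope is $\nabla_G=\operatorname{conv}\{\mathbf{e}_i-\mathbf{e}_j:(i,j)\in\mathcal{E}(G)\}$. For a facet $F$ (face of dimension $n-1$), $\mathcal{V}_F=\{i:\mathbf{e}_i-\mathbf{e}_j\in F\text{ or }\mathbf{e}_j-\mathbf{e}_i\in F\text{ for some }j\}$ and $\mathcal{E}_F=\{(i,j):\mathbf{e}_i-\mathbf{e}_j\in F\}$. "Generic" means outside a proper algebraic subset of coefficient space. *)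

theory Defs
  imports "HOL-Analysis.Analysis"
begin

text \<open>
  Nodes \<open>0, \<dots>, n\<close> are the elements of \<open>'n option\<close> with \<open>CARD('n) = n\<close>: \<open>None\<close> is the node \<open>0\<close>, and
  \<open>Some i\<close> ranges over the nodes \<open>1, \<dots>, n\<close>, which also index the coordinates of \<open>real ^ 'n\<close>.
  As types are nonempty, \<open>n \<ge> 1\<close>. A graph is given by its set of undirected edges \<open>{i, j}\<close>.
\<close>

definition simple_graph :: "'v set set \<Rightarrow> bool" where
  "simple_graph E \<longleftrightarrow> (\<forall>e\<in>E. card e = 2)"

definition directed_edges :: "'v set set \<Rightarrow> ('v \<times> 'v) set" where
  "directed_edges E = {(i, j). {i, j} \<in> E}"

definition graph_connected :: "'v set set \<Rightarrow> bool" where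
  "graph_connected E \<longleftrightarrow> (\<forall>i j. (i, j) \<in> (directed_edges E)\<^sup>*)"

definition node_vec :: "'n::finite option \<Rightarrow> real ^ 'n" where
  "node_vec i = (case i of None \<Rightarrow> 0 | Some l \<Rightarrow> axis l 1)"

definition adjacency_polytope :: "'n::finite option set set \<Rightarrow> (real ^ 'n) set" where
  "adjacency_polytope E = convex hull {node_vec i - node_vec j |i j. (i, j) \<in> directed_edges E}"

text \<open>
  A facet is a face of dimension \<open>n - 1\<close>. This is \<open>(facet_of)\<close> whenever the polytope has dimension \<open>n\<close>,
  as is the case for the adjacency polytope of a connected graph.
\<close>
definition polytope_facet :: "(real ^ 'n::finite) set \<Rightarrow> (real ^ 'n) set \<Rightarrow> bool" where
  "polytope_facet F S \<longleftrightarrow> F face_of S \<and> aff_dim F = int CARD('n) - 1"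

definition facet_nodes :: "(real ^ 'n::finite) set \<Rightarrow> 'n option set" where
  "facet_nodes F = {i. \<exists>j. node_vec i - node_vec j \<in> F \<or> node_vec j - node_vec i \<in> F}"

definition facet_edges :: "(real ^ 'n::finite) set \<Rightarrow> ('n option \<times> 'n option) set" where
  "facet_edges F = {(i, j). node_vec i - node_vec j \<in> F}"

definition weakly_connected :: "'v set \<Rightarrow> ('v \<times> 'v) set \<Rightarrow> bool" where
  "weakly_connected V A \<longleftrightarrow> (\<forall>i\<in>V. \<forall>j\<in>V. (i, j) \<in> (A \<union> A\<inverse>)\<^sup>*)"

definition primitive_network :: "'n::finite option set \<Rightarrow> ('n option \<times> 'n option) set \<Rightarrow> bool" where
  "primitive_network V A \<longleftrightarrow>
     weakly_connected V A \<and> acyclic A \<and> V = UNIV \<and> card A = CARD('n)"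

text \<open>\<open>Const_coeff k\<close> indexes \<open>c\<^sub>k\<close>, and \<open>Edge_coeff k i j\<close> indexes \<open>a\<^sub>k\<^sub>i\<^sub>j\<close>.\<close>
datatype 'n coeff = Const_coeff 'n | Edge_coeff 'n "'n option" "'n option"

definition facet_coeffs :: "(real ^ 'n::finite) set \<Rightarrow> 'n coeff set" where
  "facet_coeffs F = range Const_coeff \<union> {Edge_coeff k i j |k i j. (i, j) \<in> facet_edges F}"

definition node_value :: "complex ^ 'n::finite \<Rightarrow> 'n option \<Rightarrow> complex" where
  "node_value x i = (case i of None \<Rightarrow> 1 | Some l \<Rightarrow> x $ l)"

definition facet_subsystem ::
  "(real ^ 'n::finite) set \<Rightarrow> ('n coeff \<Rightarrow> complex) \<Rightarrow> complex ^ 'n \<Rightarrow> bool" where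
  "facet_subsystem F z x \<longleftrightarrow>
     (\<forall>k. z (Const_coeff k)
        - (\<Sum>(i, j)\<in>facet_edges F. z (Edge_coeff k i j) * (node_value x i / node_value x j)) = 0)"

text \<open>
  The affine space with coordinates indexed by \<open>I\<close> is \<open>I \<rightarrow>\<^sub>E UNIV\<close>. Polynomials on it are treated as
  functions, generated from constants and the coordinates in \<open>I\<close>.
\<close>
inductive polynomial_on :: "'v set \<Rightarrow> (('v \<Rightarrow> complex) \<Rightarrow> complex) \<Rightarrow> bool" for I where
  const: "polynomial_on I (\<lambda>z. c)"
| coord: "v \<in> I \<Longrightarrow> polynomial_on I (\<lambda>z. z v)"
| add: "polynomial_on I p \<Longrightarrow> polynomial_on I q \<Longrightarrow> polynomial_on I (\<lambda>z. p z + q z)"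
| mult: "polynomial_on I p \<Longrightarrow> polynomial_on I q \<Longrightarrow> polynomial_on I (\<lambda>z. p z * q z)"

definition algebraic_subset :: "'v set \<Rightarrow> ('v \<Rightarrow> complex) set \<Rightarrow> bool" where
  "algebraic_subset I V \<longleftrightarrow>
     (\<exists>P. (\<forall>p\<in>P. polynomial_on I p) \<and> V = {z \<in> I \<rightarrow>\<^sub>E UNIV. \<forall>p\<in>P. p z = 0})"

definition generically :: "'v set \<Rightarrow> (('v \<Rightarrow> complex) \<Rightarrow> bool) \<Rightarrow> bool" where
  "generically I Q \<longleftrightarrow>
     (\<exists>V. algebraic_subset I V \<and> V \<subset> (I \<rightarrow>\<^sub>E UNIV) \<and> (\<forall>z\<in>(I \<rightarrow>\<^sub>E UNIV) - V. Q z))"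

end

theory Submission
  imports Defs
begin

text \<open>
  Enumerate the \<open>n\<close> facet edges by \<open>'n\<close>. The facet subsystem is then a square linear system in the
  edge ratios \<open>x\<^sub>i / x\<^sub>j\<close>, and by Cramer's rule it has a unique solution, with all entries nonzero,
  unless one of \<open>n + 1\<close> nonzero polynomials (determinants) vanishes. Passing to logarithms,
  recovering \<open>x\<close> from its edge ratios amounts to inverting the map sending a potential to its
  differences along the edges. This is injective by connectedness, hence bijective as
  there are as many edges as nonzero nodes.
\<close>

lemma polynomial_on_sum:
  assumes "finite S" "\<And>s. s \<in> S \<Longrightarrow> polynomial_on I (p s)"
  shows "polynomial_on I (\<lambda>z. \<Sum>s\<in>S. p s z)"
  using assms
  by (induction S rule: finite_induct) (auto intro: polynomial_on.intros)

lemma polynomial_on_prod: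
  assumes "finite S" "\<And>s. s \<in> S \<Longrightarrow> polynomial_on I (p s)"
  shows "polynomial_on I (\<lambda>z. \<Prod>s\<in>S. p s z)"
  using assms
  by (induction S rule: finite_induct) (auto intro: polynomial_on.intros)

lemma polynomial_on_det:
  fixes M :: "('v \<Rightarrow> complex) \<Rightarrow> complex ^ 'n ^ 'n"
  assumes "\<And>i j. polynomial_on I (\<lambda>z. M z $ i $ j)"
  shows "polynomial_on I (\<lambda>z. det (M z))"
  unfolding det_def
  by (intro polynomial_on_sum polynomial_on_prod polynomial_on.mult polynomial_on.const assms)
     (simp_all add: finite_permutations)

text \<open>The exceptional set is the hypersurface \<open>p = 0\<close>, and the point
  \<open>w\<close> witnesses that it is proper. Several conditions can be imposed at once by
  multiplying their polynomials.\<close>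

lemma genericallyI:
  assumes "polynomial_on I p" and "w \<in> I \<rightarrow>\<^sub>E UNIV" and "p w \<noteq> 0"
    and "\<And>z. p z \<noteq> 0 \<Longrightarrow> Q z"
  shows "generically I Q"
  unfolding generically_def algebraic_subset_def
proof (intro exI[of _ "{z \<in> I \<rightarrow>\<^sub>E UNIV. p z = 0}"] conjI)
  show "\<exists>P. (\<forall>q\<in>P. polynomial_on I q) \<and>
          {z \<in> I \<rightarrow>\<^sub>E UNIV. p z = 0} = {z \<in> I \<rightarrow>\<^sub>E UNIV. \<forall>q\<in>P. q z = 0}"
    using assms(1) by (intro exI[of _ "{p}"]) auto
qed (use assms in auto)

lemma weakly_connected_const:
  assumes "weakly_connected UNIV A" and "\<And>i j. (i, j) \<in> A \<Longrightarrow> f i = f j"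
  shows "f i = f j"
proof -
  have "(i, j) \<in> (A \<union> A\<inverse>)\<^sup>*"
    using assms(1) by (simp add: weakly_connected_def)
  then show ?thesis
    by (induction rule: rtrancl_induct) (auto dest: assms(2))
qed

text \<open>Equal edge ratios make the quotient of the two node values constant along edges, hence
  on all nodes by connectedness; at \<open>None\<close> it is 1.\<close>

lemma node_value_eq_if_ratios_eq:
  fixes x y :: "complex ^ 'n::finite"
  assumes conn: "weakly_connected UNIV A"
    and x: "\<And>l. x $ l \<noteq> 0" and y: "\<And>l. y $ l \<noteq> 0"
    and eq: "\<And>i j. (i, j) \<in> A \<Longrightarrow> node_value x i / node_value x j = node_value y i / node_value y j"
  shows "x = y"
proof -
  have nz: "node_value x i \<noteq> 0" "node_value y i \<noteq> 0" for i
    using x y by (auto simp: node_value_def split: option.splits)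
  have "node_value x (Some l) / node_value y (Some l) = node_value x None / node_value y None" for l
  proof (rule weakly_connected_const[OF conn])
    fix i j assume "(i, j) \<in> A"
    from eq[OF this] show "node_value x i / node_value y i = node_value x j / node_value y j"
      using nz by (simp add: divide_simps mult.commute)
  qed
  then have "x $ l = y $ l" for l
    using y by (simp add: node_value_def)
  then show ?thesis by (simp add: vec_eq_iff)
qed

lemma edge_potential_exists:
  fixes e :: "'n::finite \<Rightarrow> 'n option \<times> 'n option" and w :: "complex ^ 'n"
  assumes conn: "weakly_connected UNIV (range e)"
  obtains u :: "'n option \<Rightarrow> complex"
  where "u None = 0" "\<And>l. u (fst (e l)) - u (snd (e l)) = w $ l"
proof -
  \<comment> \<open>Fixing the potential to be 0 at \<open>None\<close> removes the freedom of
    adding a constant and makes \<open>D\<close> an endomorphism of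
    \<open>complex ^ 'n\<close>.\<close>
  define pot :: "complex ^ 'n \<Rightarrow> 'n option \<Rightarrow> complex"
    where "pot u i = (case i of None \<Rightarrow> 0 | Some l \<Rightarrow> u $ l)" for u i
  define D :: "complex ^ 'n \<Rightarrow> complex ^ 'n"
    where "D u = (\<chi> l. pot u (fst (e l)) - pot u (snd (e l)))" for u
  have add: "pot (u + v) i = pot u i + pot v i"
    and scale: "pot (c *\<^sub>R u) i = c *\<^sub>R pot u i" for u v c i
    by (auto simp: pot_def split: option.splits)
  \<comment> \<open>Real linearity is enough, since injectivity implies surjectivity by counting
    real dimensions.\<close>
  have lin: "linear D"
    by (rule linearI) (auto simp: D_def vec_eq_iff add scale algebra_simps)
  have "u = 0" if "D u = 0" for u
  proof -
    have "pot u (Some l) = pot u None" for l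
    proof (rule weakly_connected_const[OF conn])
      fix i j assume "(i, j) \<in> range e"
      then obtain l where "e l = (i, j)" by (metis imageE)
      moreover have "D u $ l = 0"
        using that by simp
      ultimately show "pot u i = pot u j" by (simp add: D_def)
    qed
    then show ?thesis by (simp add: pot_def vec_eq_iff)
  qed
  then have "surj D"
    using lin linear_injective_imp_surjective linear_injective_0 by blast
  then obtain u where "w = D u" by blast
  then show thesis
    by (intro that[of "pot u"]) (auto simp: D_def pot_def)
qed

lemma edge_ratios_ex1:
  fixes e :: "'n::finite \<Rightarrow> 'n option \<times> 'n option" and r :: "complex ^ 'n"
  assumes conn: "weakly_connected UNIV (range e)" and r: "\<And>l. r $ l \<noteq> 0"
  shows "\<exists>!x :: complex ^ 'n. (\<forall>l. x $ l \<noteq> 0) \<and>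
           (\<chi> l. node_value x (fst (e l)) / node_value x (snd (e l))) = r"
proof (rule ex_ex1I)
  obtain u where u: "u None = 0" "\<And>l. u (fst (e l)) - u (snd (e l)) = (\<chi> l. Ln (r $ l)) $ l"
    using edge_potential_exists[OF conn, of "\<chi> l. Ln (r $ l)"] by blast
  \<comment> \<open>Exponentiating turns potential differences into ratios and keeps every entry
    nonzero. The branch of the logarithm is immaterial: only \<open>exp (Ln (r $ l)) = r $ l\<close>
    matters.\<close>
  define x :: "complex ^ 'n" where "x = (\<chi> l. exp (u (Some l)))"
  have "node_value x i = exp (u i)" for i
    by (cases i) (auto simp: node_value_def x_def u)
  then have "(\<chi> l. node_value x (fst (e l)) / node_value x (snd (e l))) = r"
    using u(2) r by (simp add: vec_eq_iff flip: exp_diff)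
  moreover have "\<forall>l. x $ l \<noteq> 0"
    by (simp add: x_def)
  ultimately show "\<exists>x :: complex ^ 'n. (\<forall>l. x $ l \<noteq> 0) \<and>
      (\<chi> l. node_value x (fst (e l)) / node_value x (snd (e l))) = r" by blast
next
  fix x y :: "complex ^ 'n"
  assume x: "(\<forall>l. x $ l \<noteq> 0) \<and> (\<chi> l. node_value x (fst (e l)) / node_value x (snd (e l))) = r"
    and y: "(\<forall>l. y $ l \<noteq> 0) \<and> (\<chi> l. node_value y (fst (e l)) / node_value y (snd (e l))) = r"
  show "x = y"
  proof (rule node_value_eq_if_ratios_eq[OF conn])
    fix i j assume "(i, j) \<in> range e"
    then obtain l where "e l = (i, j)" by (metis imageE)
    moreover have "node_value x (fst (e l)) / node_value x (snd (e l))
                 = node_value y (fst (e l)) / node_value y (snd (e l))"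
      using x y by (simp add: vec_eq_iff)
    ultimately show "node_value x i / node_value x j = node_value y i / node_value y j" by simp
  qed (use x y in auto)
qed

theorem theorem4:
  fixes E :: "'n::finite option set set" and F :: "(real ^ 'n) set"
  assumes "simple_graph E"
    and "graph_connected E"
    and "polytope_facet F (adjacency_polytope E)"
    and "primitive_network (facet_nodes F) (facet_edges F)"
  shows "generically (facet_coeffs F)
           (\<lambda>z. \<exists>!x :: complex ^ 'n. (\<forall>i. x $ i \<noteq> 0) \<and> facet_subsystem F z x)"
proof -
  have wc: "weakly_connected UNIV (facet_edges F)" and card: "card (facet_edges F) = CARD('n)"
    using assms(4) by (auto simp: primitive_network_def)
  \<comment> \<open>The edge set is finite because its cardinality is positive.\<close>
  obtain e where e: "bij_betw e (UNIV :: 'n set) (facet_edges F)"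
    using finite_same_card_bij[of "UNIV :: 'n set" "facet_edges F"] card by auto
  then have range: "range e = facet_edges F" and inj: "inj e"
    by (auto simp: bij_betw_def)
  have conn: "weakly_connected UNIV (range e)"
    using wc range by simp
  define M :: "('n coeff \<Rightarrow> complex) \<Rightarrow> complex ^ 'n ^ 'n"
    where "M z = (\<chi> k l. z (Edge_coeff k (fst (e l)) (snd (e l))))" for z
  define c :: "('n coeff \<Rightarrow> complex) \<Rightarrow> complex ^ 'n"
    where "c z = (\<chi> k. z (Const_coeff k))" for z
  \<comment> \<open>Cramer's numerators: column \<open>m\<close> of the coefficient matrix is
    replaced by the constant terms.\<close>
  define N :: "'n \<Rightarrow> ('n coeff \<Rightarrow> complex) \<Rightarrow> complex ^ 'n ^ 'n"
    where "N m z = (\<chi> k l. if l = m then c z $ k else M z $ k $ l)" for m z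
  have subsystem: "facet_subsystem F z x \<longleftrightarrow>
      M z *v (\<chi> l. node_value x (fst (e l)) / node_value x (snd (e l))) = c z" for z x
    unfolding facet_subsystem_def
    by (subst sum.reindex_bij_betw[OF e, symmetric])
       (auto simp: M_def c_def matrix_vector_mult_def vec_eq_iff case_prod_beta)
  have cramer_M: "M z *v r = c z \<longleftrightarrow> r = (\<chi> m. det (N m z) / det (M z))"
    if "det (M z) \<noteq> 0" for z r
    using cramer[OF that] by (simp add: N_def)
  have poly_c: "polynomial_on (facet_coeffs F) (\<lambda>z. c z $ k)" for k
    by (auto simp: c_def facet_coeffs_def intro!: polynomial_on.coord)
  have poly_M: "polynomial_on (facet_coeffs F) (\<lambda>z. M z $ k $ l)" for k l
    using range by (auto simp: M_def facet_coeffs_def intro!: polynomial_on.coord)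
  have poly_N: "polynomial_on (facet_coeffs F) (\<lambda>z. N m z $ k $ l)" for m k l
    using poly_c poly_M by (cases "l = m") (simp_all add: N_def)
  \<comment> \<open>At this point equation \<open>k\<close> says that the ratio along edge
    \<open>e k\<close> is 1. The restriction puts \<open>w\<close> in the extensional function
    space.\<close>
  define w :: "'n coeff \<Rightarrow> complex" where "w = restrict (\<lambda>v. case v of Const_coeff k \<Rightarrow> 1
    | Edge_coeff k i j \<Rightarrow> (if e k = (i, j) then 1 else 0)) (facet_coeffs F)"
  have "M w = mat 1"
    using range inj
    by (auto simp: M_def w_def mat_def vec_eq_iff facet_coeffs_def prod_eq_iff inj_def)
  have "c w = 1"
    by (auto simp: c_def w_def vec_eq_iff facet_coeffs_def)
  have det: "det (M w) = 1"
    using \<open>M w = mat 1\<close> by simp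
  \<comment> \<open>Here \<open>1\<close> is the all-ones vector, which solves the system at
    \<open>w\<close>. Reading Cramer's rule backwards gives the numerators without expanding any
    determinant.\<close>
  have "1 = (\<chi> m. det (N m w) / det (M w))"
    using cramer_M[of w 1] det \<open>M w = mat 1\<close> \<open>c w = 1\<close> by simp
  then have "det (N m w) = 1" for m
    using det by (simp add: vec_eq_iff)
  with det have w: "det (M w) * (\<Prod>m\<in>UNIV. det (N m w)) \<noteq> 0" by simp
  show ?thesis
  proof (rule genericallyI)
    show "polynomial_on (facet_coeffs F) (\<lambda>z. det (M z) * (\<Prod>m\<in>UNIV. det (N m z)))"
      by (intro polynomial_on.mult polynomial_on_prod polynomial_on_det poly_M poly_N) simp
    show "w \<in> facet_coeffs F \<rightarrow>\<^sub>E UNIV"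
      by (auto simp: w_def)
    show "det (M w) * (\<Prod>m\<in>UNIV. det (N m w)) \<noteq> 0" by fact
  next
    fix z assume "det (M z) * (\<Prod>m\<in>UNIV. det (N m z)) \<noteq> 0"
    then have "det (M z) \<noteq> 0" "\<And>m. det (N m z) \<noteq> 0" by auto
    \<comment> \<open>The denominator makes the vector of ratios unique, and the numerators make its
      entries nonzero, as needed to recover \<open>x\<close>.\<close>
    then show "\<exists>!x :: complex ^ 'n. (\<forall>i. x $ i \<noteq> 0) \<and> facet_subsystem F z x"
      unfolding subsystem cramer_M[OF \<open>det (M z) \<noteq> 0\<close>]
      by (intro edge_ratios_ex1[OF conn]) simp
  qed
qed

end
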